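(* Let $N\ge 2$ be an integer, let $V>g>0$ be real numbers, and let $r_1,r_2\in[0,1]$. If at least one of $r_1$ and $r_2$ is nonzero, then the auction game has no Nash equilibrium in pure strategies.
   Context: Auction game. $N\ge2$ agents $i\in[N]=\{1,\dots,N\}$ compete for a single opportunity of common value $V>0$; $g>0$ is the base fee, with $V>g$; $r_1,r_2\in[0,1]$ are the revert penalty rates on the base fee and the priority fee. Each agent $i$ chooses an action $b_i\in\mathcal B=\{\varnothing\}\cup[0,\infty)$, where $\varnothing$ means abstaining and $b_i\ge0$ is a priority-fee bid. The winner $w$ is the participating agent with the highest bid, ties being broken uniformly at random among the highest bids: for $b_i\ge 0$, $$\mathbb P(w=i\mid b)=\frac{\mathbf 1\{b_i=b_M\}}{1+\sum_{j\ne i}\mathbf 1\{b_j=b_i\}},\qquad b_M=\max\{b_j: b_j\ge0\}.$$ The payoff of agent $i$ is $$u_i(b_i\mid b_{-i})=(V-g-b_i)\,\mathbb P(w=i\mid b)-(r_1g+r_2b_i)\bigl(1-\mathbb P(w=i\mid b)\bigr)\quad\text{if } b_i\ge0,$$ and $u_i(b_i\mid b_{-i})=0$ if $b_i=\varnothing$. A pure strategy profile $b^*$ is a Nash equilibrium if $u_i(b_i^*\mid b_{-i}^* )\ge u_i(b_i\mid b^*_{-i})$ for all $i\in[N]$ and all $b_i\in\mathcal B$. *)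

theory Defs
  imports Complex_Main
begin

text \<open>
  An action is \<open>None\<close> (abstain) or \<open>Some x\<close> (participate with priority-fee bid \<open>x\<close>).
  A profile is a function on \<open>nat\<close> of which only the values on the agents \<open>{1..N}\<close> matter.
\<close>

definition actions :: "real option set" where
  "actions = {None} \<union> Some ` {0..}"

text \<open>Only meaningful if some agent in \<open>{1..N}\<close> participates.\<close>

definition highest_bid :: "nat \<Rightarrow> (nat \<Rightarrow> real option) \<Rightarrow> real" where
  "highest_bid N b = Max {x. \<exists>j\<in>{1..N}. b j = Some x}"

text \<open>
  The probability that agent \<open>i\<close> wins, with ties among the highest bids broken uniformly.
  An abstaining agent wins with probability 0.
\<close>

definition win_prob :: "nat \<Rightarrow> (nat \<Rightarrow> real option) \<Rightarrow> nat \<Rightarrow> real" where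
  "win_prob N b i =
     of_bool (b i = Some (highest_bid N b)) / (1 + (\<Sum>j\<in>{1..N} - {i}. of_bool (b j = b i)))"

definition payoff ::
  "nat \<Rightarrow> real \<Rightarrow> real \<Rightarrow> real \<Rightarrow> real \<Rightarrow> (nat \<Rightarrow> real option) \<Rightarrow> nat \<Rightarrow> real" where
  "payoff N V g r1 r2 b i =
     (case b i of
        None \<Rightarrow> 0
      | Some x \<Rightarrow> (V - g - x) * win_prob N b i - (r1 * g + r2 * x) * (1 - win_prob N b i))"

definition pure_nash_equilibrium ::
  "nat \<Rightarrow> real \<Rightarrow> real \<Rightarrow> real \<Rightarrow> real \<Rightarrow> (nat \<Rightarrow> real option) \<Rightarrow> bool" where
  "pure_nash_equilibrium N V g r1 r2 b \<longleftrightarrow>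
     (\<forall>i\<in>{1..N}. b i \<in> actions) \<and>
     (\<forall>i\<in>{1..N}. \<forall>a\<in>actions. payoff N V g r1 r2 b i \<ge> payoff N V g r1 r2 (b(i := a)) i)"

end

theory Submission
  imports Defs
begin

text \<open>
  Let \<open>M\<close> be the highest bid. If \<open>M < V - g\<close>, any agent other than a fixed top bidder wins with
  probability at most 1/2 and gains by slightly outbidding \<open>M\<close>. If \<open>M > V - g\<close>, a top bidder loses
  money and prefers to abstain. If \<open>M = V - g\<close>, a tie costs a top bidder the (positive) expected
  penalty, while an untied top bidder earns 0 and gains by lowering the bid without losing the lead.
\<close>

lemma finite_bids: "finite {x. \<exists>j\<in>{1..N::nat}. b j = Some x}"
proof -
  have "{x. \<exists>j\<in>{1..N}. b j = Some x} \<subseteq> (the \<circ> b) ` {1..N}"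
    by force
  then show ?thesis
    by (rule finite_subset) simp
qed

lemma highest_bid_ge:
  assumes "j \<in> {1..N}" "b j = Some x"
  shows "x \<le> highest_bid N b"
  unfolding highest_bid_def by (rule Max_ge[OF finite_bids]) (use assms in blast)

lemma highest_bid_attained:
  assumes "j \<in> {1..N}" "b j = Some x"
  obtains i where "i \<in> {1..N}" "b i = Some (highest_bid N b)"
proof -
  have "highest_bid N b \<in> {x. \<exists>j\<in>{1..N}. b j = Some x}"
    unfolding highest_bid_def by (rule Max_in[OF finite_bids]) (use assms in blast)
  then show ?thesis
    using that by blast
qed

lemma highest_bid_eqI:
  assumes "i \<in> {1..N}" "b i = Some x"
    and "\<And>j y. j \<in> {1..N} \<Longrightarrow> b j = Some y \<Longrightarrow> y \<le> x"
  shows "highest_bid N b = x"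
  unfolding highest_bid_def by (rule Max_eqI[OF finite_bids]) (use assms in blast)+

lemma win_prob_nonneg: "0 \<le> win_prob N b i"
  by (simp add: win_prob_def sum_nonneg)

lemma win_prob_le_1: "win_prob N b i \<le> 1"
proof -
  have "0 \<le> (\<Sum>j\<in>{1..N} - {i}. of_bool (b j = b i) :: real)"
    by (simp add: sum_nonneg)
  then show ?thesis
    by (simp add: win_prob_def)
qed

lemma win_prob_pos:
  assumes "b i = Some (highest_bid N b)"
  shows "0 < win_prob N b i"
proof -
  have "0 \<le> (\<Sum>j\<in>{1..N} - {i}. of_bool (b j = b i) :: real)"
    by (simp add: sum_nonneg)
  then show ?thesis
    using assms by (simp add: win_prob_def)
qed

text \<open>If \<open>j\<close> ties with \<open>i\<close>, the sum in the denominator contains the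
  term for \<open>i\<close>, so the denominator is at least 2; otherwise \<open>j\<close> misses the
  highest bid and the numerator is 0.\<close>

lemma win_prob_le_half:
  assumes "i \<in> {1..N}" "b i = Some (highest_bid N b)" "j \<noteq> i"
  shows "win_prob N b j \<le> 1/2"
proof (cases "b j = b i")
  case True
  have "(of_bool (b i = b j) :: real) \<le> (\<Sum>k\<in>{1..N} - {j}. of_bool (b k = b j))"
    by (rule member_le_sum) (use assms in auto)
  then have "1 \<le> (\<Sum>k\<in>{1..N} - {j}. of_bool (b k = b j) :: real)"
    using True by simp
  then have "1 / (1 + (\<Sum>k\<in>{1..N} - {j}. of_bool (b k = b j))) \<le> (1/2 :: real)"
    by (intro frac_le) simp_all
  then show ?thesis
    using True assms(2) by (simp only: win_prob_def) simp
qed (use assms in \<open>simp add: win_prob_def\<close>)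

lemma win_prob_sole_highest:
  assumes "i \<in> {1..N}" "b i = Some x"
    and less: "\<And>j y. j \<in> {1..N} \<Longrightarrow> j \<noteq> i \<Longrightarrow> b j = Some y \<Longrightarrow> y < x"
  shows "win_prob N b i = 1"
proof -
  have "highest_bid N b = x"
    by (rule highest_bid_eqI) (use assms in force)+
  moreover have "(\<Sum>j\<in>{1..N} - {i}. of_bool (b j = b i) :: real) = 0"
    by (rule sum.neutral) (use assms in force)
  ultimately show ?thesis
    by (simp add: win_prob_def assms(2))
qed

text \<open>A sure win makes the penalty term vanish. All profitable deviations other than
  abstaining are of this kind.\<close>

lemma payoff_deviation_sole_highest:
  assumes "i \<in> {1..N}"
    and "\<And>j y. j \<in> {1..N} \<Longrightarrow> j \<noteq> i \<Longrightarrow> b j = Some y \<Longrightarrow> y < x"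
  shows "payoff N V g r1 r2 (b(i := Some x)) i = V - g - x"
proof -
  have "win_prob N (b(i := Some x)) i = 1"
    by (rule win_prob_sole_highest[where x = x]) (use assms in auto)
  then show ?thesis
    by (simp add: payoff_def)
qed

lemma payoff_deviation_None: "payoff N V g r1 r2 (b(i := None)) i = 0"
  by (simp add: payoff_def)

theorem theorem3p2:
  fixes N :: nat and V g r1 r2 :: real
  assumes "N \<ge> 2"
    and "g > 0" and "V > g"
    and "r1 \<in> {0..1}" and "r2 \<in> {0..1}"
    and "r1 \<noteq> 0 \<or> r2 \<noteq> 0"
  shows "\<not> (\<exists>b. pure_nash_equilibrium N V g r1 r2 b)"
proof
  assume "\<exists>b. pure_nash_equilibrium N V g r1 r2 b"
  then obtain b where ne: "pure_nash_equilibrium N V g r1 r2 b" ..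
  let ?u = "\<lambda>i. payoff N V g r1 r2 b i"
  have bid_nonneg: "0 \<le> x" if "i \<in> {1..N}" "b i = Some x" for i x
    using ne that unfolding pure_nash_equilibrium_def actions_def by fastforce
  have abstain: "0 \<le> ?u i" if "i \<in> {1..N}" for i
    using ne that payoff_deviation_None[of N V g r1 r2 b i]
    unfolding pure_nash_equilibrium_def actions_def by force
  \<comment> \<open>Only the bids of the rivals must lie below \<open>x\<close>, so this covers both
    overbidding a leader and lowering one's own leading bid.\<close>
  have outbid: "V - g - x \<le> ?u i"
    if "i \<in> {1..N}" "0 \<le> x"
      and "\<And>j y. j \<in> {1..N} \<Longrightarrow> j \<noteq> i \<Longrightarrow> b j = Some y \<Longrightarrow> y < x" for i x
  proof -
    have "payoff N V g r1 r2 (b(i := Some x)) i \<le> ?u i"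
      using ne that(1,2) unfolding pure_nash_equilibrium_def actions_def by blast
    then show ?thesis
      using payoff_deviation_sole_highest[of i N b x] that by simp
  qed
  \<comment> \<open>If all agents abstained, agent 1 could win alone with bid 0 and earn
    \<open>V - g > 0\<close>. Hence the highest bid is the maximum of a nonempty set.\<close>
  have "\<exists>k\<in>{1..N}. \<exists>x. b k = Some x"
  proof (rule ccontr)
    assume none: "\<not> ?thesis"
    have "V - g - 0 \<le> ?u 1"
      by (rule outbid) (use none assms(1) in auto)
    moreover have "?u 1 = 0"
      using none assms(1) by (simp add: payoff_def split: option.split)
    ultimately show False
      using assms(3) by simp
  qed
  then obtain i where i: "i \<in> {1..N}" "b i = Some (highest_bid N b)"
    using highest_bid_attained by metis
  define M where "M = highest_bid N b"
  define w where "w = win_prob N b i"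
  have bi: "b i = Some M"
    using i by (simp add: M_def)
  have M_ge: "y \<le> M" if "j \<in> {1..N}" "b j = Some y" for j y
    using highest_bid_ge[of j N b y] that by (simp add: M_def)
  have M0: "0 \<le> M"
    using bid_nonneg i(1) bi by blast
  have penalty_nonneg: "0 \<le> r1 * g + r2 * x" if "0 \<le> x" for x
    using assms that by simp
  have ui: "?u i = (V - g - M) * w - (r1 * g + r2 * M) * (1 - w)"
    by (simp add: payoff_def bi w_def)
  have w: "0 < w" "w \<le> 1"
    using win_prob_pos[of b i N] i(2) win_prob_le_1[of N b i] by (simp_all add: w_def)
  have i_penalty: "0 \<le> (r1 * g + r2 * M) * (1 - w)"
    using penalty_nonneg[OF M0] w by simp
  consider "M < V - g" | "M > V - g" | "M = V - g"
    by linarith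
  then show False
  proof cases
    case 1
    define j where "j = (if i = 1 then 2 else 1 :: nat)"
    have j: "j \<in> {1..N}" "j \<noteq> i"
      using assms(1) by (auto simp: j_def)
    have half: "win_prob N b j \<le> 1/2"
      using win_prob_le_half i j(2) by blast
    \<comment> \<open>The penalty can only lower the payoff. The winning term is at most half the
      surplus for a bid equal to \<open>M\<close> and 0 for any other bid.\<close>
    have "?u j \<le> (V - g - M) / 2"
    proof (cases "b j")
      case None
      then show ?thesis
        using 1 by (simp add: payoff_def)
    next
      case (Some x)
      have pen: "0 \<le> (r1 * g + r2 * x) * (1 - win_prob N b j)"
        using penalty_nonneg[of x] bid_nonneg[of j x] j(1) Some half by simp
      have "(V - g - x) * win_prob N b j \<le> (V - g - M) / 2"
      proof (cases "x = M")
        case True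
        then show ?thesis
          using mult_left_mono[OF half, of "V - g - M"] 1 by simp
      next
        case False
        then have "win_prob N b j = 0"
          by (simp add: win_prob_def Some M_def)
        then show ?thesis
          using 1 by simp
      qed
      then show ?thesis
        using pen by (simp add: payoff_def Some)
    qed
    \<comment> \<open>Raising the bid by a quarter of the surplus \<open>V - g - M\<close> secures
      three quarters of it, more than the half just obtained as upper bound.\<close>
    moreover have "V - g - (M + (V - g - M) / 4) \<le> ?u j"
    proof (rule outbid[OF j(1)])
      show "0 \<le> M + (V - g - M) / 4"
        using M0 1 by simp
    next
      fix k y assume "k \<in> {1..N}" "k \<noteq> j" "b k = Some y"
      then have "y \<le> M"
        using M_ge by blast
      moreover have "0 < (V - g - M) / 4"
        using 1 by simp
      ultimately show "y < M + (V - g - M) / 4"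
        by linarith
    qed
    ultimately show False
      using 1 by (simp add: field_simps)
  next
    case 2
    then have "(V - g - M) * w < 0"
      using w by (simp add: mult_neg_pos)
    then show False
      using ui i_penalty abstain[OF i(1)] by linarith
  next
    case 3
    \<comment> \<open>Here a nonzero penalty rate enters: \<open>g > 0\<close> handles
      \<open>r1\<close>, and \<open>M = V - g > 0\<close> handles \<open>r2\<close>.\<close>
    have "0 < r1 * g + r2 * M"
      using assms 3 by (auto intro: add_pos_nonneg add_nonneg_pos)
    \<comment> \<open>Winning yields 0, so the payoff is minus the expected penalty; it is
      nonnegative only if losing has probability 0.\<close>
    then have "w = 1"
      using ui 3 w abstain[OF i(1)] by (simp add: mult_le_0_iff)
    have less_M: "y < M" if "j \<in> {1..N}" "j \<noteq> i" "b j = Some y" for j y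
    proof -
      have "y \<noteq> M"
      proof
        assume "y = M"
        then have "w \<le> 1/2"
          unfolding w_def using win_prob_le_half[of j N b i] that by (simp add: M_def)
        then show False
          using \<open>w = 1\<close> by simp
      qed
      then show ?thesis
        using M_ge[OF that(1,3)] by simp
    qed
    \<comment> \<open>The bids of the rivals of \<open>i\<close>. Inserting 0 keeps the set nonempty
      when no rival bids, and makes any \<open>x\<close> above its maximum an admissible
      bid.\<close>
    define S where "S = insert 0 {y. \<exists>j\<in>{1..N}. (b(i := None)) j = Some y}"
    have fin: "finite S"
      unfolding S_def using finite_bids[of N "b(i := None)"] by simp
    have "y < M" if "y \<in> S" for y
      using that less_M 3 assms(3) by (auto simp: S_def split: if_splits)
    then have "Max S < M"
      using fin by (subst Max_less_iff) (auto simp: S_def)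
    then obtain x where x: "Max S < x" "x < M"
      using dense by blast
    have S_less: "y < x" if "y \<in> S" for y
      using Max_ge[OF fin that] x by simp
    \<comment> \<open>The left side is \<open>M - x > 0\<close>, whereas the payoff of
      \<open>i\<close> is 0.\<close>
    have "V - g - x \<le> ?u i"
    proof (rule outbid[OF i(1)])
      show "0 \<le> x"
        using S_less[of 0] by (simp add: S_def)
    next
      fix j y assume "j \<in> {1..N}" "j \<noteq> i" "b j = Some y"
      then show "y < x"
        by (intro S_less) (auto simp: S_def)
    qed
    then show False
      using ui \<open>w = 1\<close> 3 x by simp
  qed
qed

end
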